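(* Let $K$ be a field and let $e,k\ge1$ be integers with $2k\le e-1$ and $e-k\ge 4$. Let $R_k=K[X_i : i\in[0,e-1]\setminus[k,2k-1]]$ and let $I_k\subset R_k$ be the defining ideal of the semigroup ring of $S_k=\langle e,\ldots,e+k-1,e+2k,\ldots,2e-1\rangle$. Then $$I_k=I_2(A^e_k)+I_2(B^e_k),$$ where $$A^e_k=\begin{bmatrix}X_0&X_1&\cdots&X_{k-2}&X_{2k}&X_{2k+1}&\cdots&X_{e-1}\\ X_1&X_2&\cdots&X_{k-1}&X_{2k+1}&X_{2k+2}&\cdots&X_0^2\end{bmatrix}$$ and $$B^e_k=\begin{bmatrix}X_{k-1}&X_{2k}&X_{2k+1}&\cdots&X_{e+k-4}&X_{e+k-3}\\ X_{2k}&X_{3k+1}&X_{3k+2}&\cdots&X_{e+2k-3}&X_{e+2k-2}=X_{k-1}^2\end{bmatrix}.$$ That is, $A^e_k$ has columns $\binom{X_i}{X_{i+1}}$ for $i\in[0,k-2]\cup[2k,e-1]$, and $B^e_k$ has first column $\binom{X_{k-1}}{X_{2k}}$ followed by the columns $\binom{X_{2k+i}}{X_{3k+1+i}}$ for $0\le i\le e-k-3$.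
   Context: $[a,b]$ is the set of integers $i$ with $a\le i\le b$ (empty if $b<a$). $I_k$ is the kernel of the $K$-algebra homomorphism $R_k\to K[t]$, $X_i\mapsto t^{e+i}$. For indices $\ge e$ the symbols $X_i$ denote monomials: $X_{e+2i}=X_i^2$ and $X_{e+2i+1}=X_iX_{i+1}$ (for those $i\ge0$ for which the right-hand side makes sense; only indices up to $e+2k-2$ are used). $I_2(M)$ is the ideal generated by the $2\times2$ minors of $M$. *)

theory Defs
  imports
    "HOL-Library.Poly_Mapping"
    "HOL-Algebra.Algebraic_Closure_Type"
    "Jordan_Normal_Form.Determinant"
    "Jordan_Normal_Form.DL_Submatrix"
begin

text \<open>
  Polynomials in countably many variables indexed by \<^typ>\<open>nat\<close>: a monomial is its exponent function,
  and the product on the outer \<^type>\<open>poly_mapping\<close> is the convolution product.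
\<close>

type_synonym 'a mpoly = "(nat \<Rightarrow>\<^sub>0 nat) \<Rightarrow>\<^sub>0 'a"

definition mconst :: "'a \<Rightarrow> 'a::comm_ring_1 mpoly" where
  "mconst c = Poly_Mapping.single 0 c"

definition mvar :: "nat \<Rightarrow> 'a::comm_ring_1 mpoly" where
  "mvar i = Poly_Mapping.single (Poly_Mapping.single i 1) 1"

definition mpoly_ring :: "nat set \<Rightarrow> 'a::comm_ring_1 mpoly ring" where
  "mpoly_ring V =
     ring_of_type_algebra \<lparr>carrier := {p. \<forall>m \<in> Poly_Mapping.keys p. Poly_Mapping.keys m \<subseteq> V}\<rparr>"

definition mono_subst :: "(nat \<Rightarrow> 'a Polynomial.poly) \<Rightarrow> (nat \<Rightarrow>\<^sub>0 nat) \<Rightarrow> 'a::comm_ring_1 Polynomial.poly" where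
  "mono_subst f m = (\<Prod>i \<in> Poly_Mapping.keys m. f i ^ Poly_Mapping.lookup m i)"

text \<open>The substitution \<open>X\<^sub>i \<mapsto> f i\<close> into \<open>K[t]\<close>.\<close>

definition mpoly_subst :: "(nat \<Rightarrow> 'a Polynomial.poly) \<Rightarrow> 'a::comm_ring_1 mpoly \<Rightarrow> 'a Polynomial.poly" where
  "mpoly_subst f p =
     (\<Sum>m \<in> Poly_Mapping.keys p. Polynomial.smult (Poly_Mapping.lookup p m) (mono_subst f m))"

definition coord_ring :: "nat \<Rightarrow> nat \<Rightarrow> 'a::comm_ring_1 mpoly ring" where
  "coord_ring e k = mpoly_ring ({0..<e} - {k..<2 * k})"

definition param_map :: "nat \<Rightarrow> 'a::comm_ring_1 mpoly \<Rightarrow> 'a Polynomial.poly" where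
  "param_map e = mpoly_subst (\<lambda>i. Polynomial.monom 1 (e + i))"

text \<open>
  The exponents \<open>e + i\<close> of the images of the variables of \<open>coord_ring e k\<close> are the generators
  \<open>e, \<dots>, e+k-1, e+2k, \<dots>, 2e-1\<close> of \<open>S\<^sub>k\<close>, so the image of \<open>param_map e\<close> is \<open>K[S\<^sub>k] \<subseteq> K[t]\<close>
  and its kernel is the defining ideal of \<open>K[S\<^sub>k]\<close>.
\<close>

definition semigroup_ideal :: "nat \<Rightarrow> nat \<Rightarrow> 'a::comm_ring_1 mpoly set" where
  "semigroup_ideal e k = a_kernel (coord_ring e k) ring_of_type_algebra (param_map e)"

definition minors :: "nat \<Rightarrow> 'a::comm_ring_1 mat \<Rightarrow> 'a set" where
  "minors r M =
     {det (submatrix M I J) | I J.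
        I \<subseteq> {..<dim_row M} \<and> J \<subseteq> {..<dim_col M} \<and> card I = r \<and> card J = r}"

definition minors_ideal :: "'a::comm_ring_1 ring \<Rightarrow> nat \<Rightarrow> 'a mat \<Rightarrow> 'a set" where
  "minors_ideal R r M = Idl\<^bsub>R\<^esub> (minors r M)"

text \<open>
  The symbol \<open>X\<^sub>n\<close>: a variable for \<open>n < e\<close>, and beyond that the monomials
  \<open>X\<^bsub>e+2i\<^esub> = X\<^sub>i\<^sup>2\<close> and \<open>X\<^bsub>e+2i+1\<^esub> = X\<^sub>i X\<^bsub>i+1\<^esub>\<close>.  It is meant only for \<open>n \<le> e + 2k - 2\<close>
  outside \<open>[k, 2k - 1]\<close>, where it lies in \<open>coord_ring e k\<close>.
\<close>

definition xsym :: "nat \<Rightarrow> nat \<Rightarrow> 'a::comm_ring_1 mpoly" where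
  "xsym e n =
     (if n < e then mvar n
      else let i = (n - e) div 2 in
        if even (n - e) then mvar i ^ 2 else mvar i * mvar (i + 1))"

text \<open>
  Both matrices have \<open>e - k - 1\<close> columns, numbered from 0; \<open>A_top k j\<close> and \<open>(B_top k j, B_bot k j)\<close>
  are the indices of the symbols in column \<open>j\<close>.
\<close>

definition A_top :: "nat \<Rightarrow> nat \<Rightarrow> nat" where
  "A_top k j = (if j < k - 1 then j else 2 * k + (j - (k - 1)))"

definition A_mat :: "nat \<Rightarrow> nat \<Rightarrow> 'a::comm_ring_1 mpoly mat" where
  "A_mat e k = mat 2 (e - k - 1) (\<lambda>(r, j). xsym e (if r = 0 then A_top k j else A_top k j + 1))"

definition B_top :: "nat \<Rightarrow> nat \<Rightarrow> nat" where
  "B_top k j = (if j = 0 then k - 1 else 2 * k + (j - 1))"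

definition B_bot :: "nat \<Rightarrow> nat \<Rightarrow> nat" where
  "B_bot k j = (if j = 0 then 2 * k else 3 * k + 1 + (j - 1))"

definition B_mat :: "nat \<Rightarrow> nat \<Rightarrow> 'a::comm_ring_1 mpoly mat" where
  "B_mat e k = mat 2 (e - k - 1) (\<lambda>(r, j). xsym e (if r = 0 then B_top k j else B_bot k j))"


text \<open>\<open>mpoly_ring V\<close> is a ring, and \<open>mpoly_subst f\<close> is the \<open>K\<close>-algebra homomorphism with \<open>X\<^sub>i \<mapsto> f i\<close>.\<close>

lemma carrier_mpoly_ring:
  "carrier (mpoly_ring V) = {p. \<forall>m \<in> Poly_Mapping.keys p. Poly_Mapping.keys m \<subseteq> V}"
  by (simp add: mpoly_ring_def)

lemma cring_mpoly_ring: "cring (mpoly_ring V :: 'a::comm_ring_1 mpoly ring)"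
proof -
  let ?T = "ring_of_type_algebra :: 'a mpoly ring"
  let ?C = "{p :: 'a mpoly. \<forall>m \<in> Poly_Mapping.keys p. Poly_Mapping.keys m \<subseteq> V}"
  interpret T: cring ?T by (rule cring_from_type_algebra)
  have neg: "\<ominus>\<^bsub>?T\<^esub> p = - p" for p :: "'a mpoly"
    by (rule T.minus_equality) (simp_all add: ring_of_type_algebra_def)
  have add: "p + q \<in> ?C" if "p \<in> ?C" "q \<in> ?C" for p q
    using that Poly_Mapping.keys_add[of p q] by blast
  have mult: "p * q \<in> ?C" if "p \<in> ?C" "q \<in> ?C" for p q
  proof safe
    fix m i assume "m \<in> Poly_Mapping.keys (p * q)" "i \<in> Poly_Mapping.keys m"
    then obtain a b where "m = a + b" "a \<in> Poly_Mapping.keys p" "b \<in> Poly_Mapping.keys q"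
      using keys_mult[of p q] by blast
    moreover from this have "i \<in> Poly_Mapping.keys a \<union> Poly_Mapping.keys b"
      using \<open>i \<in> Poly_Mapping.keys m\<close> Poly_Mapping.keys_add[of a b] by blast
    ultimately show "i \<in> V" using that by blast
  qed
  have "subcring ?C ?T"
  proof (rule T.subcringI', rule T.subringI)
    show "?C \<subseteq> carrier ?T" by (simp add: ring_of_type_algebra_def)
    show "\<one>\<^bsub>?T\<^esub> \<in> ?C" by (simp add: ring_of_type_algebra_def flip: single_one)
    show "\<ominus>\<^bsub>?T\<^esub> p \<in> ?C" if "p \<in> ?C" for p using that by (simp add: neg)
    show "p \<otimes>\<^bsub>?T\<^esub> q \<in> ?C" if "p \<in> ?C" "q \<in> ?C" for p q
      using mult[OF that] by (simp add: ring_of_type_algebra_def)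
    show "p \<oplus>\<^bsub>?T\<^esub> q \<in> ?C" if "p \<in> ?C" "q \<in> ?C" for p q
      using add[OF that] by (simp add: ring_of_type_algebra_def)
  qed
  then show ?thesis
    unfolding mpoly_ring_def by (rule T.subcring_iff[THEN iffD1, rotated]) (simp add: ring_of_type_algebra_def)
qed

lemma mono_subst_superset:
  assumes "finite S" "Poly_Mapping.keys m \<subseteq> S"
  shows "mono_subst f m = (\<Prod>i \<in> S. f i ^ Poly_Mapping.lookup m i)"
  unfolding mono_subst_def
  by (rule prod.mono_neutral_left) (use assms in \<open>auto simp: in_keys_iff\<close>)

lemma mono_subst_add: "mono_subst f (m + n) = mono_subst f m * mono_subst f n"
proof -
  let ?S = "Poly_Mapping.keys m \<union> Poly_Mapping.keys n"
  have "Poly_Mapping.keys (m + n) \<subseteq> ?S" by (rule Poly_Mapping.keys_add)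
  then show ?thesis
    by (simp add: mono_subst_superset[of ?S] lookup_add power_add prod.distrib)
qed

lemma mpoly_subst_superset:
  assumes "finite S" "Poly_Mapping.keys p \<subseteq> S"
  shows "mpoly_subst f p = (\<Sum>m \<in> S. Polynomial.smult (Poly_Mapping.lookup p m) (mono_subst f m))"
  unfolding mpoly_subst_def
  by (rule sum.mono_neutral_left) (use assms in \<open>auto simp: in_keys_iff\<close>)

lemma mpoly_subst_add: "mpoly_subst f (p + q) = mpoly_subst f p + mpoly_subst f q"
proof -
  let ?S = "Poly_Mapping.keys p \<union> Poly_Mapping.keys q"
  have "Poly_Mapping.keys (p + q) \<subseteq> ?S" by (rule Poly_Mapping.keys_add)
  then show ?thesis
    by (simp add: mpoly_subst_superset[of ?S] lookup_add smult_add_left sum.distrib)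
qed

lemma mpoly_subst_single: "mpoly_subst f (Poly_Mapping.single m c) = Polynomial.smult c (mono_subst f m)"
  by (simp add: mpoly_subst_superset[of "{m}"])

lemma mpoly_subst_0: "mpoly_subst f 0 = 0"
  by (simp add: mpoly_subst_def)

lemma mpoly_subst_mult: "mpoly_subst f (p * q) = mpoly_subst f p * mpoly_subst f q"
proof (induction p rule: update_induct)
  case const
  then show ?case by (simp add: mpoly_subst_0)
next
  case (update p m c)
  have single: "mpoly_subst f (Poly_Mapping.single m c * q) =
      mpoly_subst f (Poly_Mapping.single m c) * mpoly_subst f q"
  proof (induction q rule: update_induct)
    case const
    then show ?case by (simp add: mpoly_subst_0)
  next
    case (update q n d)
    then have "Poly_Mapping.update n d q = q + Poly_Mapping.single n d"
      by (intro poly_mapping_eqI) (auto simp: lookup_update lookup_add lookup_single when_def in_keys_iff)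
    with update.IH show ?case
      by (simp add: distrib_left mpoly_subst_add mult_single mpoly_subst_single mono_subst_add mult.commute)
  qed
  have "Poly_Mapping.update m c p = p + Poly_Mapping.single m c"
    using update.hyps
    by (intro poly_mapping_eqI) (auto simp: lookup_update lookup_add lookup_single when_def in_keys_iff)
  with update.IH show ?case
    by (simp add: distrib_right mpoly_subst_add single)
qed

lemma mpoly_subst_mconst: "mpoly_subst f (mconst c) = [:c:]"
  by (simp add: mconst_def mpoly_subst_single mono_subst_def)

lemma mpoly_subst_mvar: "mpoly_subst f (mvar i) = f i"
  by (simp add: mvar_def mpoly_subst_single mono_subst_def)

lemma mpoly_subst_ring_hom: "mpoly_subst f \<in> Ring.ring_hom (mpoly_ring V) ring_of_type_algebra"
  by (rule ring_hom_memI)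
    (simp_all add: mpoly_ring_def ring_of_type_algebra_def mpoly_subst_mult mpoly_subst_add
      mpoly_subst_mconst[of f 1, unfolded mconst_def] flip: single_one one_pCons)

lemma xsym_closed:
  assumes "n \<in> {0..e + 2 * k - 2} - {k..<2 * k}" and "1 \<le> k" and "2 * k \<le> e - 1"
  shows "xsym e n \<in> carrier (coord_ring e k :: 'a::comm_ring_1 mpoly ring)"
proof -
  let ?R = "coord_ring e k :: 'a mpoly ring"
  interpret cring ?R unfolding coord_ring_def by (rule cring_mpoly_ring)
  have mvar: "mvar i \<in> carrier ?R" if "i < e" "i < k \<or> 2 * k \<le> i" for i
    using that by (auto simp: coord_ring_def carrier_mpoly_ring mvar_def)
  have mult: "x * y \<in> carrier ?R" if "x \<in> carrier ?R" "y \<in> carrier ?R" for x y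
    using m_closed[OF that] by (simp add: coord_ring_def mpoly_ring_def ring_of_type_algebra_def)
  show ?thesis
  proof (cases "n < e")
    case True
    with assms show ?thesis by (auto simp: xsym_def intro!: mvar)
  next
    case False
    define i where "i = (n - e) div 2"
    have bound: "n - e \<le> 2 * (k - 1)"
      using assms by auto
    then have "i < k"
      using assms(2) unfolding i_def by linarith
    moreover have "i + 1 < k" if "odd (n - e)"
      using bound that assms(2) unfolding i_def by presburger
    ultimately have "i < k" and "odd (n - e) \<Longrightarrow> i + 1 < k" by blast+
    with False assms show ?thesis
      by (auto simp: xsym_def Let_def power2_eq_square simp flip: i_def intro!: mvar mult)
  qed
qed

text \<open>The matrix entries, hence the minors, lie in \<open>coord_ring e k\<close>, as \<open>Idl\<close> presupposes.\<close>

lemma A_B_mat_closed: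
  assumes "1 \<le> k" and "2 * k \<le> e - 1" and "4 \<le> e - k" and "r < 2" and "j < e - k - 1"
  shows "A_mat e k $$ (r, j) \<in> carrier (coord_ring e k :: 'a::comm_ring_1 mpoly ring)"
    and "B_mat e k $$ (r, j) \<in> carrier (coord_ring e k :: 'a::comm_ring_1 mpoly ring)"
  using assms by (auto simp: A_mat_def B_mat_def A_top_def B_top_def B_bot_def intro!: xsym_closed)

end

theory Submission
  imports Defs
begin

text \<open>
  Give \<open>X\<^sub>i\<close> the weight \<open>e + i\<close>. The minors of both matrices are differences of monomials of equal
  weight, since the weight grows by 1 from top to bottom in every column of the first matrix and by
  \<open>k + 1\<close> in every column of the second; this gives one inclusion
  (\<open>minors_A_B_le_semigroup_ideal\<close>).

  For the other inclusion it suffices that any two monomials of equal weight are congruent modulo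
  the minors (\<open>same_weight_eqv\<close>): an element of the kernel is a combination of differences of such
  monomials (\<open>mem_ideal_if_param_map_eq_0\<close>). The congruence is obtained by dividing by \<open>X\<^sub>0\<close>, whose
  weight \<open>e\<close> is the multiplicity of the semigroup. Every monomial is congruent either to a multiple
  of \<open>X\<^sub>0\<close> or to one of \<open>e\<close> explicit monomials (\<open>reducible_or_apery\<close>): 1, the other variables,
  \<open>X\<^bsub>k-1\<^esub> X\<^sub>c\<close> with \<open>0 < c < k\<close>, and \<open>X\<^bsub>2k\<^esub> X\<^bsub>e-1\<^esub>\<close>. Their weights form the Apery set of the
  semigroup with respect to \<open>e\<close>: pairwise different, and outside the semigroup after subtracting
  \<open>e\<close> (\<open>apery_not_reducible\<close>). So the weight decides which alternative occurs, and induction on the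
  weight finishes.

  The dichotomy need only be checked for a variable times one of the explicit monomials, hence for
  quadratic and a few cubic monomials. The first matrix slides indices: \<open>X\<^sub>i X\<^sub>j\<close> depends only on
  \<open>i + j\<close> while neither factor crosses the gap \<open>[k, 2k-1]\<close>, and an index that reaches \<open>e\<close> turns into
  \<open>X\<^sub>0\<^sup>2\<close>. The first column of the second matrix crosses the gap: it trades
  \<open>X\<^bsub>2k\<^esub>\<close> against \<open>X\<^bsub>k-1\<^esub>\<close>.
\<close>

section \<open>Monomials and their weights\<close>

definition semigroup_gen :: "nat \<Rightarrow> nat \<Rightarrow> nat \<Rightarrow> bool" where
  "semigroup_gen e k i \<longleftrightarrow> i < k \<or> 2 * k \<le> i \<and> i < e"

text \<open>
  Carrying the weight alongside the monomial makes weight preservation part of every rewriting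
  step, so that no grading has to be recovered from the congruence itself.
\<close>

inductive monomial_of_weight :: "nat \<Rightarrow> nat \<Rightarrow> (nat \<Rightarrow> 'a::comm_monoid_mult) \<Rightarrow> nat \<Rightarrow> 'a \<Rightarrow> bool"
  for e k x where
  one: "monomial_of_weight e k x 0 1"
| var: "semigroup_gen e k i \<Longrightarrow> monomial_of_weight e k x n p
    \<Longrightarrow> monomial_of_weight e k x (e + i + n) (x i * p)"

lemma monomial_of_weight_var:
  "semigroup_gen e k i \<Longrightarrow> monomial_of_weight e k x (e + i) (x i)"
  using monomial_of_weight.var[OF _ monomial_of_weight.one] by fastforce

lemma monomial_of_weight_mult:
  assumes "monomial_of_weight e k x m p" and "monomial_of_weight e k x n q"
  shows "monomial_of_weight e k x (m + n) (p * q)"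
  using assms
proof (induction rule: monomial_of_weight.induct)
  case (var i m p)
  then show ?case
    using monomial_of_weight.var[of e k i x "m + n" "p * q"] by (simp add: mult.assoc add.assoc)
qed simp

section \<open>Rewriting monomials modulo the minors\<close>

text \<open>
  The rewriting argument uses only the congruence that the minors generate on monomials, so it is
  carried out in a commutative monoid. Here \<open>y n\<close> stands for the symbol with index \<open>n\<close>, which is
  \<open>x n\<close> below \<open>e\<close> and a balanced product of two generators from \<open>e\<close> on. Each minor taken
  from the second matrix pairs its first column, the one whose entries lie on different sides of the
  gap, with the column whose top entry has index \<open>c\<close>.
\<close>

locale minor_congruence =
  fixes e k :: nat
    and x :: "nat \<Rightarrow> 'a::comm_monoid_mult"
    and eqv :: "'a \<Rightarrow> 'a \<Rightarrow> bool"  (infix "\<simeq>\<^sub>J" 50)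
  assumes k_pos: "1 \<le> k" and gap: "2 * k < e" and tail: "k + 4 \<le> e"
    and eqv_refl: "p \<simeq>\<^sub>J p"
    and eqv_sym: "p \<simeq>\<^sub>J q \<Longrightarrow> q \<simeq>\<^sub>J p"
    and eqv_trans: "p \<simeq>\<^sub>J q \<Longrightarrow> q \<simeq>\<^sub>J r \<Longrightarrow> p \<simeq>\<^sub>J r"
    and eqv_mult_var: "i < k \<or> 2 * k \<le> i \<and> i < e \<Longrightarrow> p \<simeq>\<^sub>J q \<Longrightarrow> x i * p \<simeq>\<^sub>J x i * q"
  fixes y :: "nat \<Rightarrow> 'a"
  assumes y_var: "n < e \<Longrightarrow> y n = x n"
    and y_quad: "a \<le> b \<Longrightarrow> b \<le> a + 1 \<Longrightarrow> y (e + a + b) = x a * x b"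
    and minor_A: "\<lbrakk>i + 1 < k \<or> 2 * k \<le> i \<and> i < e; j + 1 < k \<or> 2 * k \<le> j \<and> j < e\<rbrakk>
      \<Longrightarrow> y i * y (j + 1) \<simeq>\<^sub>J y (i + 1) * y j"
    and minor_B: "\<lbrakk>2 * k \<le> c; c + 3 \<le> e + k\<rbrakk> \<Longrightarrow> x (k - 1) * y (c + k + 1) \<simeq>\<^sub>J x (2 * k) * y c"
begin

lemmas bounds = k_pos gap tail

declare eqv_trans [trans] 

abbreviation is_gen :: "nat \<Rightarrow> bool" where "is_gen \<equiv> semigroup_gen e k"

abbreviation wmon :: "nat \<Rightarrow> 'a \<Rightarrow> bool" where "wmon \<equiv> monomial_of_weight e k x"

lemma eqv_mult: "wmon n r \<Longrightarrow> p \<simeq>\<^sub>J q \<Longrightarrow> r * p \<simeq>\<^sub>J r * q"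
proof (induction rule: monomial_of_weight.induct)
  case (var i n r)
  then show ?case
    using eqv_mult_var[of i "r * p" "r * q"] by (simp add: mult.assoc semigroup_gen_def)
qed simp

lemma wmon_quad: "is_gen i \<Longrightarrow> is_gen j \<Longrightarrow> wmon (2 * e + i + j) (x i * x j)"
  using monomial_of_weight_mult[of e k x "e + i" "x i" "e + j" "x j"]
    monomial_of_weight_var[of e k _ x] unfolding mult_2 by (simp add: add.assoc add.left_commute)

lemma y_halves:
  assumes "e \<le> n"
  obtains a b where "n = e + a + b" "a \<le> b" "b \<le> a + 1" "y n = x a * x b"
proof -
  obtain d where d: "n = e + d" using assms le_Suc_ex by blast
  have "\<exists>a b. d = a + b \<and> a \<le> b \<and> b \<le> a + 1"
    by (intro exI[of _ "d div 2"] exI[of _ "d - d div 2"]) linarith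
  then obtain a b where ab: "d = a + b" "a \<le> b" "b \<le> a + 1" by blast
  show ?thesis
    by (rule that[of a b]) (use ab d y_quad[of a b] in \<open>simp_all add: add.assoc\<close>)
qed

lemma y_e: "y e = x 0 * x 0"
  using y_quad[of 0 0] by simp

lemma wmon_y:
  assumes "n < k \<or> 2 * k \<le> n" and "n + 2 \<le> e + 2 * k"
  shows "wmon (e + n) (y n)"
proof (cases "n < e")
  case True
  then show ?thesis using assms monomial_of_weight_var by (auto simp: y_var semigroup_gen_def)
next
  case False
  then obtain a b where ab: "n = e + a + b" "a \<le> b" "b \<le> a + 1" "y n = x a * x b"
    by (metis y_halves not_less)
  \<comment> \<open>The bound \<open>e + 2 * k - 2\<close> on \<open>n\<close> keeps both halves of \<open>n - e\<close> below the gap.\<close>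
  then have "a < k" "b < k" using assms bounds by linarith+
  then show ?thesis
    using ab wmon_quad[of a b] by (simp add: semigroup_gen_def mult_2 add.assoc)
qed

text \<open>
  A minor of the first matrix trades one index step between the two factors. The range conditions
  say that every column crossed on the way is present; sliding stops at the gap and at index \<open>e\<close>.
\<close>

lemma slide:
  assumes "\<And>s. s < t \<Longrightarrow> i + s + 1 < k \<or> 2 * k \<le> i + s \<and> i + s < e"
    and "\<And>s. s < t \<Longrightarrow> j + s + 1 < k \<or> 2 * k \<le> j + s \<and> j + s < e"
  shows "y (i + t) * y j \<simeq>\<^sub>J y i * y (j + t)"
  using assms
proof (induction t arbitrary: j)
  case 0
  show ?case by (simp add: eqv_refl)
next
  case (Suc t)
  have "y (i + t) * y (j + 1) \<simeq>\<^sub>J y (i + t + 1) * y j"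
    using Suc.prems(1)[of t] Suc.prems(2)[of 0] by (intro minor_A) auto
  then have "y (i + Suc t) * y j \<simeq>\<^sub>J y (i + t) * y (j + 1)"
    using eqv_sym by simp
  also have "\<dots> \<simeq>\<^sub>J y i * y (j + 1 + t)"
    using Suc.prems(1) Suc.prems(2)[of "Suc _"] by (intro Suc.IH) auto
  finally show ?case by simp
qed

text \<open>
  Hence a product of two symbols depends only on the sum of the indices, as long as each factor
  stays on its side of the gap. The upper side includes the index \<open>e\<close>, whose symbol is
  \<open>x 0 * x 0\<close>: sliding a factor up to \<open>e\<close> is how powers of \<open>x 0\<close> appear.
\<close>

lemma equal_index_sum:
  assumes "i + j = i' + j'"
    and "i < k \<and> i' < k \<or> 2 * k \<le> i \<and> i \<le> e \<and> 2 * k \<le> i' \<and> i' \<le> e"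
    and "j < k \<and> j' < k \<or> 2 * k \<le> j \<and> j \<le> e \<and> 2 * k \<le> j' \<and> j' \<le> e"
  shows "y i * y j \<simeq>\<^sub>J y i' * y j'"
proof -
  have up: "y (i + t) * y j \<simeq>\<^sub>J y i * y (j + t)"
    if "i + t < k \<or> 2 * k \<le> i \<and> i + t \<le> e" "j + t < k \<or> 2 * k \<le> j \<and> j + t \<le> e" for i j t
    using that by (intro slide) auto
  show ?thesis
  proof (cases "i' \<le> i")
    case True
    then obtain t where "i = i' + t" "j' = j + t"
      using assms(1) that[of "i - i'"] by linarith
    then show ?thesis using up[of i' t j] assms by blast
  next
    case False
    then obtain t where "i' = i + t" "j = j' + t"
      using assms(1) that[of "i' - i"] by linarith
    then show ?thesis using up[of i t j', THEN eqv_sym] assms by blast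
  qed
qed

definition reducible :: "nat \<Rightarrow> 'a \<Rightarrow> bool" where
  "reducible n p \<longleftrightarrow> (\<exists>m q. n = e + m \<and> wmon m q \<and> p \<simeq>\<^sub>J x 0 * q)"

lemma reducibleI: "p \<simeq>\<^sub>J x 0 * q \<Longrightarrow> wmon m q \<Longrightarrow> n = e + m \<Longrightarrow> reducible n p"
  unfolding reducible_def by blast

lemma reducible_eqv: "reducible n q \<Longrightarrow> p \<simeq>\<^sub>J q \<Longrightarrow> reducible n p"
  unfolding reducible_def using eqv_trans by blast

lemma reducible_mult:
  assumes "reducible n p" and r: "wmon m r"
  shows "reducible (m + n) (r * p)"
proof -
  obtain l q where q: "n = e + l" "wmon l q" "p \<simeq>\<^sub>J x 0 * q"
    using assms(1) unfolding reducible_def by blast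
  have "r * p \<simeq>\<^sub>J x 0 * (r * q)"
    using eqv_mult[OF r q(3)] by (simp add: mult.left_commute)
  then show ?thesis
    using q monomial_of_weight_mult[OF r q(2)] by (auto intro: reducibleI)
qed

lemma reducible_mult_var:
  "reducible n p \<Longrightarrow> is_gen i \<Longrightarrow> reducible (e + i + n) (x i * p)"
  using reducible_mult monomial_of_weight_var by blast

lemma small_small_reducible:
  assumes "a + b < k"
  shows "reducible (2 * e + a + b) (x a * x b)"
proof -
  have "x a * x b \<simeq>\<^sub>J x 0 * x (a + b)"
    using equal_index_sum[of a b 0 "a + b"] assms bounds by (simp add: y_var)
  then show ?thesis
    using assms by (auto intro: reducibleI[OF _ monomial_of_weight_var] simp: semigroup_gen_def)
qed

lemma small_large_reducible:
  assumes a: "a < k" and b: "2 * k \<le> b" "b < e"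
  shows "reducible (2 * e + a + b) (x a * x b)"
proof (cases "a + b \<le> e")
  case True
  have "x a * x b \<simeq>\<^sub>J x 0 * y (a + b)"
    using equal_index_sum[of a b 0 "a + b"] assms bounds True by (simp add: y_var)
  moreover have "wmon (e + (a + b)) (y (a + b))"
    using assms bounds True by (intro wmon_y) auto
  ultimately show ?thesis
    by (auto intro: reducibleI)
next
  case False
  have "x a * x b \<simeq>\<^sub>J x (a + b - e) * (x 0 * x 0)"
    using equal_index_sum[of a b "a + b - e" e] assms bounds False by (simp add: y_var y_e)
  also have "\<dots> = x 0 * (x 0 * x (a + b - e))"
    by (simp add: ac_simps)
  finally show ?thesis
    using assms bounds False
    by (auto intro!: reducibleI[OF _ wmon_quad] simp: semigroup_gen_def)
qed

text \<open>
  If the index sum is large, one factor slides up to \<open>e\<close>. Otherwise it slides down and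
  the product becomes \<open>x (2 * k) * y c\<close>, which the second matrix turns into \<open>x (k - 1) * y (c + k + 1)\<close>: a factor below
  the gap has appeared, so the previous two cases apply. At the excluded sum the
  weight lies in the Apery set.
\<close>

lemma large_large_reducible:
  assumes a: "2 * k \<le> a" "a < e" and b: "2 * k \<le> b" "b < e" and ne: "a + b \<noteq> e + 2 * k - 1"
  shows "reducible (2 * e + a + b) (x a * x b)"
proof (cases "e + 2 * k \<le> a + b")
  case True
  have "x a * x b \<simeq>\<^sub>J x (a + b - e) * (x 0 * x 0)"
  proof -
    have "2 * k \<le> a + b - e" "a + b - e < e" "a + b - e + e = a + b" "2 * k \<le> e"
      using assms bounds True by linarith+
    then show ?thesis
      using equal_index_sum[of a b "a + b - e" e] a b by (simp add: y_var y_e)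
  qed
  also have "\<dots> = x 0 * (x 0 * x (a + b - e))"
    by (simp add: ac_simps)
  finally show ?thesis
    using assms bounds True
    by (auto intro!: reducibleI[OF _ wmon_quad] simp: semigroup_gen_def)
next
  case False
  define c where "c = a + b - 2 * k"
  have c: "2 * k \<le> c" "c + 2 \<le> e" "a + b = c + 2 * k"
    using assms False unfolding c_def by linarith+
  have "x a * x b \<simeq>\<^sub>J x (2 * k) * y c"
    using equal_index_sum[of a b "2 * k" c] assms bounds c by (simp add: y_var)
  also have "\<dots> \<simeq>\<^sub>J x (k - 1) * y (c + k + 1)"
    using minor_B[of c] c bounds eqv_sym by simp
  finally have step: "x a * x b \<simeq>\<^sub>J x (k - 1) * y (c + k + 1)" .
  have "reducible (2 * e + a + b) (x (k - 1) * y (c + k + 1))"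
  proof (cases "c + k + 1 < e")
    case True
    then have "reducible (2 * e + (k - 1) + (c + k + 1)) (x (k - 1) * x (c + k + 1))"
      using c bounds by (intro small_large_reducible) auto
    moreover have "2 * e + (k - 1) + (c + k + 1) = 2 * e + a + b"
      using c bounds by linarith
    ultimately show ?thesis using True y_var by metis
  next
    case False
    then obtain u v where uv: "c + k + 1 = e + u + v" "y (c + k + 1) = x u * x v"
      by (metis y_halves not_less)
    then have "u + v < k" using c by linarith
    then have "reducible (e + (k - 1) + (2 * e + u + v)) (x (k - 1) * (x u * x v))"
      using bounds by (intro reducible_mult_var small_small_reducible) (auto simp: semigroup_gen_def)
    moreover have "e + (k - 1) + (2 * e + u + v) = 2 * e + a + b"
      using uv(1) c(3) bounds by linarith
    ultimately show ?thesis using uv(2) by metis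
  qed
  then show ?thesis using step reducible_eqv by blast
qed

text \<open>
  The disjuncts list representatives of the Apery set of the semigroup with respect to \<open>e\<close>, the
  least element of every residue class. Classes \<open>k, \<dots>, 2 * k - 2\<close> need two small generators, and
  in class \<open>2 * k - 1\<close> the weight \<open>2 * e + 2 * k - 1\<close> is missing too, since no two indices of
  generators sum to \<open>2 * k - 1\<close>.
\<close>

definition apery :: "nat \<Rightarrow> 'a \<Rightarrow> bool" where
  "apery n p \<longleftrightarrow> n = 0 \<and> p \<simeq>\<^sub>J 1
    \<or> (\<exists>r. is_gen r \<and> 0 < r \<and> n = e + r \<and> p \<simeq>\<^sub>J x r)
    \<or> (\<exists>c. 0 < c \<and> c < k \<and> n = 2 * e + (k - 1) + c \<and> p \<simeq>\<^sub>J x (k - 1) * x c)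
    \<or> n = 3 * e + 2 * k - 1 \<and> p \<simeq>\<^sub>J x (2 * k) * x (e - 1)"

lemma quad_class:
  assumes i: "is_gen i" and j: "is_gen j"
  shows "reducible (2 * e + i + j) (x i * x j) \<or> apery (2 * e + i + j) (x i * x j)"
proof -
  consider "i + j < k" | "i < k" "j < k" "k \<le> i + j" 
    | "i < k" "2 * k \<le> j" | "j < k" "2 * k \<le> i" 
    | "2 * k \<le> i" "2 * k \<le> j" "i + j \<noteq> e + 2 * k - 1"
    | "2 * k \<le> i" "2 * k \<le> j" "i + j = e + 2 * k - 1"
    using assms unfolding semigroup_gen_def by linarith
  then show ?thesis
  proof cases
    case 1
    then show ?thesis using small_small_reducible by blast
  next
    case 2
    then have "x i * x j \<simeq>\<^sub>J x (k - 1) * x (i + j - (k - 1))"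
      using equal_index_sum[of i j "k - 1" "i + j - (k - 1)"] bounds by (simp add: y_var)
    moreover have "0 < i + j - (k - 1)" "i + j - (k - 1) < k"
        "2 * e + i + j = 2 * e + (k - 1) + (i + j - (k - 1))"
      using 2 bounds by linarith+
    ultimately show ?thesis unfolding apery_def by blast
  next
    case 3
    then show ?thesis using small_large_reducible j by (auto simp: semigroup_gen_def)
  next
    case 4
    then show ?thesis using small_large_reducible[of j i] i by (auto simp: semigroup_gen_def ac_simps)
  next
    case 5
    then show ?thesis using large_large_reducible i j by (auto simp: semigroup_gen_def)
  next
    case 6
    then have "x i * x j \<simeq>\<^sub>J x (2 * k) * x (e - 1)"
      using equal_index_sum[of i j "2 * k" "e - 1"] i j bounds by (simp add: y_var semigroup_gen_def)
    then show ?thesis using 6 bounds unfolding apery_def by auto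
  qed
qed

text \<open>
  The critical case is \<open>i < k \<le> i + c\<close>, where no factor of degree two is reducible. Then
  \<open>x i * x c\<close> is a symbol beyond \<open>e\<close>, and the second matrix moves it, together with \<open>x (k - 1)\<close>,
  to \<open>x (2 * k) * y d\<close>. Either \<open>d = e - 1\<close> and the last representative of the Apery set is
  reached, or \<open>y d\<close> is again a product of two small generators, one of which combines with
  \<open>x (2 * k)\<close> to a reducible product.
\<close>

lemma cubic_class:
  assumes i: "is_gen i" and c: "0 < c" "c < k"
  defines "n \<equiv> e + i + (2 * e + (k - 1) + c)" and "p \<equiv> x i * (x (k - 1) * x c)"
  shows "reducible n p \<or> apery n p"
proof -
  have p: "p = x (k - 1) * (x i * x c)" and n: "n = e + (k - 1) + (2 * e + i + c)"
    unfolding p_def n_def by (simp_all add: ac_simps)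
  have gen: "is_gen (k - 1)" "is_gen (2 * k)" using bounds by (auto simp: semigroup_gen_def)
  consider "2 * k \<le> i" | "i + c < k" | "i < k" "k \<le> i + c"
    using i unfolding semigroup_gen_def by linarith
  then show ?thesis
  proof cases
    case 1
    then have "reducible (2 * e + i + c) (x i * x c)"
      using small_large_reducible[of c i] i c by (auto simp: semigroup_gen_def ac_simps)
    then show ?thesis unfolding p n using reducible_mult_var gen by blast
  next
    case 2
    then show ?thesis unfolding p n
      using reducible_mult_var gen small_small_reducible by blast
  next
    case 3
    \<comment> \<open>The second matrix pairs the bottom entry \<open>y (e + i + c)\<close> with the top entry \<open>y d\<close>.\<close>
    define d where "d = e + i + c - (k + 1)"
    have d: "2 * k \<le> d" "d + 3 \<le> e + k" "e + i + c = d + k + 1"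
      using 3 c bounds unfolding d_def by linarith+
    obtain u v where uv: "e + i + c = e + u + v" "u \<le> v" "v \<le> u + 1" "y (e + i + c) = x u * x v"
      using y_halves[of "e + i + c"] by auto
    have "u < k" "v < k" using uv 3 c by linarith+
    then have "x i * x c \<simeq>\<^sub>J y (d + k + 1)"
      using equal_index_sum[of i c u v] uv 3 c bounds d by (simp add: y_var)
    then have "p \<simeq>\<^sub>J x (k - 1) * y (d + k + 1)"
      unfolding p using gen(1) eqv_mult_var semigroup_gen_def by blast
    also have "\<dots> \<simeq>\<^sub>J x (2 * k) * y d"
      using d by (intro minor_B)
    finally have p': "p \<simeq>\<^sub>J x (2 * k) * y d" .
    show ?thesis
    proof (cases "i + c = k")
      case True
      then have "n = 3 * e + 2 * k - 1" "d = e - 1" "e - 1 < e"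
        using bounds unfolding n_def d_def by linarith+
      then show ?thesis using p' unfolding apery_def by (simp add: y_var)
    next
      case False
      then have "e \<le> d" using 3 unfolding d_def by linarith
      then obtain s t where st: "d = e + s + t" "y d = x s * x t" "s \<le> t" "t \<le> s + 1"
        by (metis y_halves)
      have "s < k" "t < k" using st d by linarith+
      then have "reducible (e + t + (2 * e + s + 2 * k)) (x t * (x s * x (2 * k)))"
        using bounds by (intro reducible_mult_var small_large_reducible) (auto simp: semigroup_gen_def)
      moreover have "e + t + (2 * e + s + 2 * k) = n"
        using st(1) d(3) bounds unfolding n by linarith
      ultimately show ?thesis
        using p' reducible_eqv st(2) by (simp add: ac_simps)
    qed
  qed
qed

text \<open>
  For \<open>i \<noteq> 2 * k\<close> the factor \<open>x i * x (e - 1)\<close> is already reducible. For \<open>i = 2 * k\<close> the square of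
  \<open>x (2 * k)\<close> is one of the two products in a minor of the second matrix; the other one contains
  \<open>x (k - 1)\<close>, which reduces against \<open>x (e - 1)\<close>.
\<close>

lemma apery_top_reducible:
  assumes i: "is_gen i"
  shows "reducible (e + i + (3 * e + 2 * k - 1)) (x i * (x (2 * k) * x (e - 1)))"
proof -
  have gen: "is_gen (2 * k)" "is_gen (k - 1)" using bounds by (auto simp: semigroup_gen_def)
  show ?thesis
  proof (cases "i = 2 * k")
    case False
    have "reducible (2 * e + i + (e - 1)) (x i * x (e - 1))"
    proof (cases "i < k")
      case True
      then show ?thesis using bounds by (intro small_large_reducible) auto
    next
      case False
      then show ?thesis using i \<open>i \<noteq> 2 * k\<close> bounds
        by (intro large_large_reducible) (auto simp: semigroup_gen_def)
    qed
    then have "reducible (e + 2 * k + (2 * e + i + (e - 1))) (x (2 * k) * (x i * x (e - 1)))"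
      using reducible_mult_var gen by blast
    moreover have "e + 2 * k + (2 * e + i + (e - 1)) = e + i + (3 * e + 2 * k - 1)"
      using bounds by linarith
    ultimately show ?thesis by (metis mult.left_commute)
  next
    case True
    have "x (2 * k) * x (2 * k) \<simeq>\<^sub>J x (k - 1) * y (3 * k + 1)"
      using minor_B[of "2 * k"] bounds by (simp add: y_var eqv_sym)
    then have "x (e - 1) * (x (2 * k) * x (2 * k)) \<simeq>\<^sub>J x (e - 1) * (x (k - 1) * y (3 * k + 1))"
      using bounds by (intro eqv_mult_var) auto
    moreover have "reducible (e + (3 * k + 1) + (2 * e + (k - 1) + (e - 1)))
        (y (3 * k + 1) * (x (k - 1) * x (e - 1)))"
      using bounds by (intro reducible_mult small_large_reducible wmon_y) auto
    moreover have "e + (3 * k + 1) + (2 * e + (k - 1) + (e - 1)) = e + 2 * k + (3 * e + 2 * k - 1)"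
      using bounds by linarith
    moreover have "x (e - 1) * (x (k - 1) * y (3 * k + 1)) = y (3 * k + 1) * (x (k - 1) * x (e - 1))"
      and "x i * (x (2 * k) * x (e - 1)) = x (e - 1) * (x (2 * k) * x (2 * k))"
      using True by (simp_all only: ac_simps)
    ultimately show ?thesis
      using True reducible_eqv by metis
  qed
qed

lemma reducible_or_apery:
  "wmon n p \<Longrightarrow> reducible n p \<or> apery n p"
proof (induction rule: monomial_of_weight.induct)
  case one
  then show ?case by (simp add: apery_def eqv_refl)
next
  case (var i n p)
  have gen: "is_gen i" by (fact var.hyps)
  have transfer: "reducible m (x i * p) \<or> apery m (x i * p)"
    if "p \<simeq>\<^sub>J q" "reducible m (x i * q) \<or> apery m (x i * q)" for m q
  proof -
    have eqv: "x i * p \<simeq>\<^sub>J x i * q"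
      using that(1) gen eqv_mult_var semigroup_gen_def by blast
    from that(2) show ?thesis
    proof
      assume "reducible m (x i * q)"
      then show ?thesis using eqv reducible_eqv by blast
    next
      assume "apery m (x i * q)"
      then show ?thesis using eqv_trans[OF eqv] unfolding apery_def by blast
    qed
  qed
  from var.IH show ?case
  proof
    assume "reducible n p"
    then show ?thesis using reducible_mult_var gen by blast
  next
    assume "apery n p"
    then consider "n = 0" "p \<simeq>\<^sub>J 1"
      | r where "is_gen r" "n = e + r" "p \<simeq>\<^sub>J x r"
      | c where "0 < c" "c < k" "n = 2 * e + (k - 1) + c" "p \<simeq>\<^sub>J x (k - 1) * x c"
      | "n = 3 * e + 2 * k - 1" "p \<simeq>\<^sub>J x (2 * k) * x (e - 1)"
      unfolding apery_def by blast
    then show ?thesis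
    proof cases
      case 1
      have "reducible (e + i) (x i * 1) \<or> apery (e + i) (x i * 1)"
      proof (cases "i = 0")
        case True
        then show ?thesis by (auto intro!: reducibleI[OF _ monomial_of_weight.one] eqv_refl)
      next
        case False
        then show ?thesis using gen by (auto simp: apery_def eqv_refl)
      qed
      then show ?thesis using transfer 1 by simp
    next
      case 2
      have "e + i + n = 2 * e + i + r" using 2 by simp
      then show ?thesis using transfer[OF 2(3)] quad_class[OF gen 2(1)] by metis
    next
      case 3
      then show ?thesis using transfer[OF 3(4)] cubic_class[OF gen] by blast
    next
      case 4
      then show ?thesis using transfer[OF 4(2)] apery_top_reducible[OF gen] by blast
    qed
  qed
qed

lemma wmon_weight_cases:
  "wmon n p \<Longrightarrow> n = 0 \<or> (\<exists>i. is_gen i \<and> n = e + i)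
    \<or> (\<exists>i j. is_gen i \<and> is_gen j \<and> n = 2 * e + i + j) \<or> 3 * e \<le> n"
proof (induction rule: monomial_of_weight.induct)
  case (var i n p)
  then show ?case by fastforce
qed simp

text \<open>
  This is where the Apery set earns its name: subtracting \<open>e\<close> from one of its weights leaves the
  semigroup. The weight obtained is too small for three generators, so only sums of at most two
  have to be excluded, and those miss it because their indices avoid the gap.
\<close>

lemma apery_not_reducible:
  assumes "apery n p"
  shows "\<not> reducible n q"
proof
  assume "reducible n q"
  then obtain m r where m: "n = e + m" "wmon m r" unfolding reducible_def by blast
  note cases = wmon_weight_cases[OF m(2)]
  show False
    using assms cases bounds unfolding apery_def semigroup_gen_def m(1) by auto
qed

text \<open>
  The four families have disjoint weights, and within a family the weight fixes the parameter.
\<close>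

lemma apery_unique:
  assumes p: "apery n p" and q: "apery n q"
  shows "p \<simeq>\<^sub>J q"
proof -
  have join: "p \<simeq>\<^sub>J q" if "p \<simeq>\<^sub>J r" "q \<simeq>\<^sub>J r" for r
    using that eqv_sym eqv_trans by blast
  consider "n = 0" "p \<simeq>\<^sub>J 1"
    | r where "is_gen r" "0 < r" "n = e + r" "p \<simeq>\<^sub>J x r"
    | c where "0 < c" "c < k" "n = 2 * e + (k - 1) + c" "p \<simeq>\<^sub>J x (k - 1) * x c"
    | "n = 3 * e + 2 * k - 1" "p \<simeq>\<^sub>J x (2 * k) * x (e - 1)"
    using p unfolding apery_def by blast
  then show ?thesis
  proof cases
    case 1
    then have "q \<simeq>\<^sub>J 1" using q bounds unfolding apery_def by auto
    then show ?thesis using join 1 by blast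
  next
    case (2 r)
    have "r < e" "n \<noteq> 0" "\<And>c. n \<noteq> 2 * e + (k - 1) + c" "n \<noteq> 3 * e + 2 * k - 1"
      using 2 bounds unfolding semigroup_gen_def by linarith+
    then have "q \<simeq>\<^sub>J x r" using q 2(3) unfolding apery_def by auto
    then show ?thesis using join 2 by blast
  next
    case (3 c)
    have "n \<noteq> 0" "n \<noteq> 3 * e + 2 * k - 1" "\<And>r. is_gen r \<Longrightarrow> n \<noteq> e + r"
      using 3 bounds unfolding semigroup_gen_def by linarith+
    then have "q \<simeq>\<^sub>J x (k - 1) * x c" using q 3(3) unfolding apery_def by auto
    then show ?thesis using join 3 by blast
  next
    case 4
    have "n \<noteq> 0" "\<And>r. is_gen r \<Longrightarrow> n \<noteq> e + r" "\<And>c. c < k \<Longrightarrow> n \<noteq> 2 * e + (k - 1) + c"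
      using 4 bounds unfolding semigroup_gen_def by linarith+
    then have "q \<simeq>\<^sub>J x (2 * k) * x (e - 1)" using q unfolding apery_def by blast
    then show ?thesis using join 4 by blast
  qed
qed

text \<open>
  Whether a monomial is reducible depends on its weight only. Two reducible monomials are
  compared after cancelling \<open>x 0\<close>, by induction on the weight; two irreducible ones are congruent
  to the same representative.
\<close>

lemma same_weight_eqv: "wmon n p \<Longrightarrow> wmon n q \<Longrightarrow> p \<simeq>\<^sub>J q"
proof (induction n arbitrary: p q rule: less_induct)
  case (less n)
  show ?case
  proof (cases "reducible n p")
    case True
    then have "\<not> apery n q" using apery_not_reducible by blast
    then have "reducible n q" using less.prems(2) reducible_or_apery by blast
    then obtain m p' q' where m: "n = e + m" and p': "wmon m p'" "p \<simeq>\<^sub>J x 0 * p'"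
      and q': "wmon m q'" "q \<simeq>\<^sub>J x 0 * q'"
      using True unfolding reducible_def by auto
    have "m < n" using m bounds by simp
    then have "p' \<simeq>\<^sub>J q'" using less.IH p'(1) q'(1) by blast
    then have "x 0 * p' \<simeq>\<^sub>J x 0 * q'"
      using k_pos by (intro eqv_mult_var) auto
    from eqv_trans[OF p'(2) eqv_trans[OF this eqv_sym[OF q'(2)]]] show ?thesis .
  next
    case False
    then have p: "apery n p"
      using less.prems(1) reducible_or_apery by blast
    then have "apery n q"
      using less.prems(2) reducible_or_apery apery_not_reducible by blast
    with p show ?thesis by (rule apery_unique)
  qed
qed

end

section \<open>Ideals of the polynomial ring\<close>

lemma mpoly_ring_simps:
  "\<zero>\<^bsub>mpoly_ring V\<^esub> = 0"
  "p \<oplus>\<^bsub>mpoly_ring V\<^esub> q = p + q" "p \<otimes>\<^bsub>mpoly_ring V\<^esub> q = p * q"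
  by (simp_all add: mpoly_ring_def ring_of_type_algebra_def)

lemma mpoly_ring_uminus_closed:
  "p \<in> carrier (mpoly_ring V) \<Longrightarrow> - p \<in> carrier (mpoly_ring V)"
  by (simp add: carrier_mpoly_ring)

lemma mpoly_ring_mult_closed:
  fixes p q :: "'a::comm_ring_1 mpoly"
  assumes "p \<in> carrier (mpoly_ring V)" "q \<in> carrier (mpoly_ring V)"
  shows "p * q \<in> carrier (mpoly_ring V)"
proof -
  interpret cring "mpoly_ring V :: 'a mpoly ring" by (rule cring_mpoly_ring)
  show ?thesis using m_closed[OF assms] by (simp add: mpoly_ring_simps)
qed

lemma mpoly_ring_minus_closed:
  fixes p q :: "'a::comm_ring_1 mpoly"
  assumes "p \<in> carrier (mpoly_ring V)" "q \<in> carrier (mpoly_ring V)"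
  shows "p - q \<in> carrier (mpoly_ring V)"
proof -
  interpret cring "mpoly_ring V :: 'a mpoly ring" by (rule cring_mpoly_ring)
  show ?thesis
    using a_closed[OF assms(1) mpoly_ring_uminus_closed[OF assms(2)]] by (simp add: mpoly_ring_simps)
qed

lemma mconst_sum: "mconst (sum f A) = (\<Sum>i \<in> A. mconst (f i))"
  by (induction A rule: infinite_finite_induct) (simp_all add: mconst_def single_add)

lemma mconst_closed: "mconst c \<in> carrier (mpoly_ring V)"
  by (auto simp: mconst_def carrier_mpoly_ring)

lemma mvar_closed: "i \<in> V \<Longrightarrow> mvar i \<in> carrier (mpoly_ring V)"
  by (auto simp: mvar_def carrier_mpoly_ring)

context
  fixes V :: "nat set" and J :: "'a::comm_ring_1 mpoly set"
  assumes J: "ideal J (mpoly_ring V)"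
begin

lemma mpoly_ideal_0: "0 \<in> J"
  using additive_subgroup.zero_closed[OF ideal.axioms(1)[OF J]] by (simp add: mpoly_ring_simps)

lemma mpoly_ideal_add: "p \<in> J \<Longrightarrow> q \<in> J \<Longrightarrow> p + q \<in> J"
  using additive_subgroup.a_closed[OF ideal.axioms(1)[OF J]] by (simp add: mpoly_ring_simps)

lemma mpoly_ideal_mult: "p \<in> J \<Longrightarrow> r \<in> carrier (mpoly_ring V) \<Longrightarrow> r * p \<in> J"
  using ideal.I_l_closed[OF J] by (simp add: mpoly_ring_simps)

lemma mpoly_ideal_uminus: "p \<in> J \<Longrightarrow> - p \<in> J"
proof -
  have "- 1 \<in> carrier (mpoly_ring V :: 'a mpoly ring)"
    using mpoly_ring_uminus_closed[OF mconst_closed[of 1]] by (simp add: mconst_def)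
  then show "p \<in> J \<Longrightarrow> - p \<in> J" using mpoly_ideal_mult[of p "- 1"] by simp
qed

lemma mpoly_ideal_sum: "(\<And>i. i \<in> A \<Longrightarrow> f i \<in> J) \<Longrightarrow> sum f A \<in> J"
  by (induction A rule: infinite_finite_induct) (auto intro: mpoly_ideal_0 mpoly_ideal_add)

end

section \<open>Maximal minors of matrices with two rows\<close>

lemma det_2:
  fixes A :: "'a::comm_ring_1 mat"
  assumes "A \<in> carrier_mat 2 2"
  shows "det A = A $$ (0, 0) * A $$ (1, 1) - A $$ (0, 1) * A $$ (1, 0)"
proof -
  have "{..<2::nat} = {0, 1}" by auto
  moreover have "mat_delete A i 0 \<in> carrier_mat 1 1" for i
    using assms by (auto simp: mat_delete_def)
  ultimately show ?thesis
    using assms by (simp add: laplace_expansion_column[OF assms, of 0] cofactor_def det_single)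
      (simp add: mat_delete_def algebra_simps)
qed

lemma minors_two_rows:
  fixes M :: "'a::comm_ring_1 mat"
  assumes "dim_row M = 2"
  shows "minors 2 M =
    {M $$ (0, i) * M $$ (1, j) - M $$ (0, j) * M $$ (1, i) | i j. i < j \<and> j < dim_col M}"
proof -
  have det: "det (submatrix M I J) =
      M $$ (0, pick J 0) * M $$ (1, pick J 1) - M $$ (0, pick J 1) * M $$ (1, pick J 0)"
    if I: "I \<subseteq> {..<2}" "card I = 2" and J: "J \<subseteq> {..<dim_col M}" "card J = 2" for I J
  proof -
    \<comment> \<open>Both rows are selected, so only the column set carries information.\<close>
    have "I = {..<2}" using I by (intro card_subset_eq) auto
    have "pick I 0 \<in> I" "pick I 1 \<in> I" "pick I 0 < pick I 1"
      using pick_in_set_le[of 0 I] pick_in_set_le[of 1 I] pick_mono_le[of 1 I 0] I by auto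
    then have "pick I 0 = 0" "pick I 1 = 1" using I by auto
    moreover have "{i. i < dim_row M \<and> i \<in> I} = I" "{j. j < dim_col M \<and> j \<in> J} = J"
      using I J assms by auto
    ultimately show ?thesis
      using I J by (subst det_2) (auto simp: submatrix_def)
  qed
  show ?thesis
  proof (intro equalityI subsetI)
    fix d assume "d \<in> minors 2 M"
    then obtain I J where IJ: "I \<subseteq> {..<2}" "card I = 2" "J \<subseteq> {..<dim_col M}" "card J = 2"
      and d: "d = det (submatrix M I J)"
      using assms by (auto simp: minors_def)
    have "pick J 1 \<in> J" "pick J 0 < pick J 1"
      using pick_in_set_le[of 1 J] pick_mono_le[of 1 J 0] IJ by auto
    then show "d \<in> {M $$ (0, i) * M $$ (1, j) - M $$ (0, j) * M $$ (1, i) | i j. i < j \<and> j < dim_col M}"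
      using det[OF IJ] d IJ by blast
  next
    fix d assume "d \<in> {M $$ (0, i) * M $$ (1, j) - M $$ (0, j) * M $$ (1, i) | i j. i < j \<and> j < dim_col M}"
    then obtain i j where ij: "i < j" "j < dim_col M"
      and d: "d = M $$ (0, i) * M $$ (1, j) - M $$ (0, j) * M $$ (1, i)" by blast
    have J: "{i, j} \<subseteq> {..<dim_col M}" "card {i, j} = 2" using ij by auto
    have "pick {i, j} 0 \<in> {i, j}" "pick {i, j} 1 \<in> {i, j}" "pick {i, j} 0 < pick {i, j} 1"
      using pick_in_set_le[of 0 "{i, j}"] pick_in_set_le[of 1 "{i, j}"] pick_mono_le[of 1 "{i, j}" 0] J
      by auto
    then have "pick {i, j} 0 = i" "pick {i, j} 1 = j" using ij by auto
    then have "det (submatrix M {..<2} {i, j}) = d" using det[of "{..<2}", OF _ _ J] d by simp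
    then show "d \<in> minors 2 M" using J assms unfolding minors_def by fastforce
  qed
qed

text \<open>
  The last two facts drop the order of the columns: the minor changes sign under a swap and
  vanishes on equal columns. They also replace subsets of the column set by pairs of indices.
\<close>

lemma minors_ideal_two_rows:
  fixes M :: "'a::comm_ring_1 mpoly mat"
  assumes dim: "dim_row M = 2"
    and entries: "\<And>r j. r < 2 \<Longrightarrow> j < dim_col M \<Longrightarrow> M $$ (r, j) \<in> carrier (mpoly_ring V)"
  shows "ideal (minors_ideal (mpoly_ring V) 2 M) (mpoly_ring V)"
    and "i < dim_col M \<Longrightarrow> j < dim_col M \<Longrightarrow>
      M $$ (0, i) * M $$ (1, j) - M $$ (1, i) * M $$ (0, j) \<in> minors_ideal (mpoly_ring V) 2 M"
    and "\<lbrakk>ideal I (mpoly_ring V); \<And>i j. i < dim_col M \<Longrightarrow> j < dim_col M \<Longrightarrow>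
        M $$ (0, i) * M $$ (1, j) - M $$ (1, i) * M $$ (0, j) \<in> I\<rbrakk>
      \<Longrightarrow> minors_ideal (mpoly_ring V) 2 M \<subseteq> I"
proof -
  interpret cring "mpoly_ring V :: 'a mpoly ring" by (rule cring_mpoly_ring)
  have sub: "minors 2 M \<subseteq> carrier (mpoly_ring V)"
    unfolding minors_two_rows[OF dim]
    by (auto intro!: mpoly_ring_minus_closed mpoly_ring_mult_closed entries)
  show id: "ideal (minors_ideal (mpoly_ring V) 2 M) (mpoly_ring V)"
    unfolding minors_ideal_def by (rule genideal_ideal[OF sub])
  have lt: "M $$ (0, i) * M $$ (1, j) - M $$ (1, i) * M $$ (0, j) \<in> minors_ideal (mpoly_ring V) 2 M"
    if "i < j" "j < dim_col M" for i j
    using genideal_self[OF sub] that unfolding minors_ideal_def minors_two_rows[OF dim]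
    by (auto simp: mult.commute)
  show "M $$ (0, i) * M $$ (1, j) - M $$ (1, i) * M $$ (0, j) \<in> minors_ideal (mpoly_ring V) 2 M"
    if ij: "i < dim_col M" "j < dim_col M"
  proof (cases i j rule: linorder_cases)
    case less
    then show ?thesis using lt ij by blast
  next
    case equal
    then show ?thesis using mpoly_ideal_0[OF id] by (simp add: mult.commute)
  next
    case greater
    then show ?thesis using mpoly_ideal_uminus[OF id lt[OF greater ij(1)]] by (simp add: mult.commute)
  qed
  show "minors_ideal (mpoly_ring V) 2 M \<subseteq> I" if "ideal I (mpoly_ring V)"
    "\<And>i j. i < dim_col M \<Longrightarrow> j < dim_col M \<Longrightarrow>
        M $$ (0, i) * M $$ (1, j) - M $$ (1, i) * M $$ (0, j) \<in> I"
    unfolding minors_ideal_def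
  proof (rule genideal_minimal[OF that(1)], rule subsetI)
    fix d assume "d \<in> minors 2 M"
    then show "d \<in> I" using that(2) less_trans unfolding minors_two_rows[OF dim]
      by (auto simp: mult.commute)
  qed
qed

section \<open>The kernel of the parametrisation\<close>

lemma monomial_of_weight_single:
  assumes "Poly_Mapping.keys m \<subseteq> {0..<e} - {k..<2 * k}"
  shows "\<exists>n. monomial_of_weight e k mvar n (Poly_Mapping.single m 1 :: 'a::comm_ring_1 mpoly)"
  using assms
proof (induction m rule: update_induct)
  case const
  show ?case using monomial_of_weight.one by (metis single_one)
next
  case (update m i a)
  have keys: "Poly_Mapping.keys (Poly_Mapping.update i a m) = insert i (Poly_Mapping.keys m)"
    using update.hyps by (auto simp: in_keys_iff lookup_update split: if_splits)
  then have gen: "semigroup_gen e k i"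
    using update.prems by (auto simp: semigroup_gen_def)
  have power: "\<exists>n. monomial_of_weight e k mvar n (Poly_Mapping.single (Poly_Mapping.single i a) 1 :: 'a mpoly)"
    for a
  proof (induction a)
    case 0
    show ?case using monomial_of_weight.one by (metis single_one single_zero)
  next
    case (Suc a)
    have "Poly_Mapping.single (Poly_Mapping.single i (Suc a)) 1 =
        (mvar i * Poly_Mapping.single (Poly_Mapping.single i a) 1 :: 'a mpoly)"
      by (simp add: mvar_def mult_single flip: single_add)
    then show ?case using Suc monomial_of_weight.var[OF gen] by metis
  qed
  have "Poly_Mapping.update i a m = Poly_Mapping.single i a + m"
    using update.hyps
    by (intro poly_mapping_eqI) (auto simp: lookup_update lookup_add lookup_single when_def in_keys_iff)
  then have "Poly_Mapping.single (Poly_Mapping.update i a m) 1 =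
      (Poly_Mapping.single (Poly_Mapping.single i a) 1 * Poly_Mapping.single m 1 :: 'a mpoly)"
    by (simp add: mult_single)
  moreover have "\<exists>n. monomial_of_weight e k mvar n (Poly_Mapping.single m 1 :: 'a mpoly)"
    using update.IH update.prems keys by blast
  ultimately show ?case using power monomial_of_weight_mult by metis
qed

lemma param_map_monomial_of_weight:
  "monomial_of_weight e k mvar n p \<Longrightarrow> param_map e p = Polynomial.monom 1 n"
proof (induction rule: monomial_of_weight.induct)
  case one
  show ?case using mpoly_subst_mconst[of _ 1]
    by (simp add: param_map_def mconst_def one_pCons)
next
  case (var i n p)
  then show ?case
    by (simp add: param_map_def mpoly_subst_mult mpoly_subst_mvar mult_monom)
qed

lemma semigroup_ideal_alt:
  "semigroup_ideal e k = {p \<in> carrier (coord_ring e k). param_map e p = 0}"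
  by (simp add: semigroup_ideal_def a_kernel_def' ring_of_type_algebra_def)

lemma ideal_semigroup_ideal:
  "ideal (semigroup_ideal e k :: 'a::comm_ring_1 mpoly set) (coord_ring e k)"
proof -
  have "ring_hom_ring (coord_ring e k :: 'a mpoly ring) ring_of_type_algebra (param_map e)"
    unfolding coord_ring_def param_map_def
    by (intro ring_hom_ringI2 cring.axioms(1) cring_mpoly_ring cring_from_type_algebra mpoly_subst_ring_hom)
  then show ?thesis unfolding semigroup_ideal_def by (rule ring_hom_ring.kernel_is_ideal)
qed

text \<open>
  The kernel of a monomial map is spanned by differences of monomials of equal weight. Fixing one
  representative per weight and replacing every monomial of \<open>p\<close> by it changes \<open>p\<close> only by elements
  of \<open>J\<close>; what remains collects, for each weight \<open>n\<close>, the coefficient of \<open>t\<^sup>n\<close> in the image of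
  \<open>p\<close>, and is therefore zero.
\<close>

lemma mem_ideal_if_param_map_eq_0:
  fixes J :: "'a::comm_ring_1 mpoly set"
  assumes J: "ideal J (mpoly_ring V)"
    and weight: "\<And>m. Poly_Mapping.keys m \<subseteq> V \<Longrightarrow> param_map e (Poly_Mapping.single m 1) = Polynomial.monom (1 :: 'a) (w m)"
    and cong: "\<And>m m'. \<lbrakk>Poly_Mapping.keys m \<subseteq> V; Poly_Mapping.keys m' \<subseteq> V; w m = w m'\<rbrakk>
      \<Longrightarrow> Poly_Mapping.single m 1 - Poly_Mapping.single m' 1 \<in> J"
    and p: "p \<in> carrier (mpoly_ring V)" "param_map e p = 0"
  shows "p \<in> J"
proof -
  let ?K = "Poly_Mapping.keys p" and ?c = "Poly_Mapping.lookup p"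
  define mon where "mon m = (Poly_Mapping.single m 1 :: 'a mpoly)" for m
  define rep where "rep n = mon (SOME m. Poly_Mapping.keys m \<subseteq> V \<and> w m = n)" for n
  have K: "Poly_Mapping.keys m \<subseteq> V" if "m \<in> ?K" for m
    using p(1) that by (auto simp: carrier_mpoly_ring)
  have diff: "mon m - rep (w m) \<in> J" if "m \<in> ?K" for m
    unfolding mon_def rep_def
    using someI[of "\<lambda>m'. Poly_Mapping.keys m' \<subseteq> V \<and> w m' = w m" m] K[OF that] by (intro cong) auto
  have coeff0: "(\<Sum>m \<in> {m \<in> ?K. w m = n}. ?c m) = 0" for n
  proof -
    have "mono_subst (\<lambda>i. Polynomial.monom 1 (e + i)) m = Polynomial.monom (1 :: 'a) (w m)" if "m \<in> ?K" for m
      using weight[OF K[OF that]] by (simp add: param_map_def mpoly_subst_single)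
    then have "param_map e p = (\<Sum>m \<in> ?K. Polynomial.monom (?c m) (w m))"
      by (simp add: param_map_def mpoly_subst_def smult_monom)
    then have "Polynomial.coeff (\<Sum>m \<in> ?K. Polynomial.monom (?c m) (w m)) n = 0"
      using p(2) by simp
    then show ?thesis by (simp add: coeff_sum sum.If_cases Int_def)
  qed
  have "(\<Sum>m \<in> ?K. mconst (?c m) * rep (w m)) =
      (\<Sum>n \<in> w ` ?K. \<Sum>m \<in> {m \<in> ?K. w m = n}. mconst (?c m) * rep (w m))"
    by (rule sum.image_gen) simp
  also have "\<dots> = (\<Sum>n \<in> w ` ?K. mconst (\<Sum>m \<in> {m \<in> ?K. w m = n}. ?c m) * rep n)"
    by (simp add: mconst_sum sum_distrib_right)
  also have "\<dots> = 0" by (simp add: coeff0 mconst_def)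
  finally have zero: "(\<Sum>m \<in> ?K. mconst (?c m) * rep (w m)) = 0" .
  \<comment> \<open>With \<open>zero\<close>, the representatives can be subtracted from the monomials of \<open>p\<close>.\<close>
  have decomp: "p = (\<Sum>m \<in> ?K. mconst (?c m) * mon m)"
    by (intro poly_mapping_eqI)
      (simp add: mon_def mconst_def mult_single lookup_sum lookup_single when_def in_keys_iff)
  have "(\<Sum>m \<in> ?K. mconst (?c m) * mon m) = (\<Sum>m \<in> ?K. mconst (?c m) * (mon m - rep (w m)))"
    using zero by (simp add: right_diff_distrib sum_subtractf)
  also have "\<dots> \<in> J"
    by (intro mpoly_ideal_sum[OF J] mpoly_ideal_mult[OF J] diff mconst_closed)
  finally show ?thesis using decomp by simp
qed

section \<open>The minors as generators\<close>

lemma A_top_index: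
  assumes "1 \<le> k" "2 * k < e"
  assumes "i + 1 < k \<or> 2 * k \<le> i \<and> i < e"
  obtains c where "c < e - k - 1" "A_top k c = i"
proof (cases "i + 1 < k")
  case True
  then show ?thesis using assms by (intro that[of i]) (auto simp: A_top_def)
next
  case False
  then show ?thesis using assms by (intro that[of "i - 2 * k + (k - 1)"]) (auto simp: A_top_def)
qed

lemma dim_A_B_mat [simp]:
  "dim_row (A_mat e k) = 2" "dim_col (A_mat e k) = e - k - 1"
  "dim_row (B_mat e k) = 2" "dim_col (B_mat e k) = e - k - 1"
  by (simp_all add: A_mat_def B_mat_def)

lemma minors_ideals_congruence:
  fixes J :: "'a::comm_ring_1 mpoly set"
  assumes bounds: "1 \<le> k" "2 * k < e" "k + 4 \<le> e"
    and J: "ideal J (coord_ring e k)"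
    and A: "minors_ideal (coord_ring e k) 2 (A_mat e k) \<subseteq> J"
    and B: "minors_ideal (coord_ring e k) 2 (B_mat e k) \<subseteq> J"
  shows "minor_congruence e k mvar (\<lambda>p q. p - q \<in> J) (xsym e)"
proof
  note J' = J[unfolded coord_ring_def]
  have AB: "A_mat e k $$ (r, j) \<in> carrier (coord_ring e k :: 'a mpoly ring)"
    "B_mat e k $$ (r, j) \<in> carrier (coord_ring e k :: 'a mpoly ring)"
    if "r < 2" "j < e - k - 1" for r j
    using A_B_mat_closed[of k e r j] that bounds
      diff_le_mono[OF Suc_leI[OF bounds(2)], of 1] le_diff_conv2[of k e 4] by simp_all
  show "1 \<le> k" "2 * k < e" "k + 4 \<le> e" by (fact bounds)+
  show "p - p \<in> J" for p :: "'a mpoly" using mpoly_ideal_0[OF J'] by simp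
  show "q - p \<in> J" if "p - q \<in> J" for p q :: "'a mpoly"
    using mpoly_ideal_uminus[OF J' that] by simp
  show "p - r \<in> J" if "p - q \<in> J" "q - r \<in> J" for p q r :: "'a mpoly"
    using mpoly_ideal_add[OF J' that] by simp
  show "mvar i * p - mvar i * q \<in> J" if "i < k \<or> 2 * k \<le> i \<and> i < e" "p - q \<in> J"
    for i and p q :: "'a mpoly"
    using mpoly_ideal_mult[OF J' that(2) mvar_closed[of i]] that(1) bounds
    by (auto simp: right_diff_distrib)
  show "xsym e n = (mvar n :: 'a mpoly)" if "n < e" for n
    using that by (simp add: xsym_def)
  show "xsym e (e + a + b) = (mvar a * mvar b :: 'a mpoly)" if "a \<le> b" "b \<le> a + 1" for a b
  proof -
    have "b = a \<or> b = a + 1" using that by auto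
    then show ?thesis by (auto simp: xsym_def power2_eq_square add.assoc)
  qed
  have minor_A: "A_mat e k $$ (0, c) * A_mat e k $$ (1, d) - A_mat e k $$ (1, c) * A_mat e k $$ (0, d) \<in> J"
    if "c < e - k - 1" "d < e - k - 1" for c d
    by (intro subsetD[OF A] minors_ideal_two_rows(2)[where V = "{0..<e} - {k..<2 * k}", folded coord_ring_def])
      (use that AB in \<open>simp_all add: coord_ring_def\<close>)
  have minor_B: "B_mat e k $$ (0, c) * B_mat e k $$ (1, d) - B_mat e k $$ (1, c) * B_mat e k $$ (0, d) \<in> J"
    if "c < e - k - 1" "d < e - k - 1" for c d
    by (intro subsetD[OF B] minors_ideal_two_rows(2)[where V = "{0..<e} - {k..<2 * k}", folded coord_ring_def])
      (use that AB in \<open>simp_all add: coord_ring_def\<close>)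
  show "xsym e i * xsym e (j + 1) - xsym e (i + 1) * xsym e j \<in> J"
    if i: "i + 1 < k \<or> 2 * k \<le> i \<and> i < e" and j: "j + 1 < k \<or> 2 * k \<le> j \<and> j < e" for i j
  proof -
    obtain c where c: "c < e - k - 1" "A_top k c = i"
      using A_top_index[OF bounds(1,2) i] .
    obtain d where d: "d < e - k - 1" "A_top k d = j"
      using A_top_index[OF bounds(1,2) j] .
    show ?thesis using minor_A[OF c(1) d(1)] c d by (simp add: A_mat_def)
  qed
  show "mvar (k - 1) * xsym e (c + k + 1) - mvar (2 * k) * xsym e c \<in> J"
    if "2 * k \<le> c" "c + 3 \<le> e + k" for c
  proof -
    \<comment> \<open>The minor of column 0 and the column whose top entry has index \<open>c\<close>.\<close>
    have j: "0 < e - k - 1" "c - 2 * k + 1 < e - k - 1" "3 * k + 1 + (c - 2 * k) = c + k + 1"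
      using that bounds by linarith+
    have indices: "B_top k 0 = k - 1" "B_bot k 0 = 2 * k"
      "B_top k (c - 2 * k + 1) = c" "B_bot k (c - 2 * k + 1) = c + k + 1"
      using that j(3) by (simp_all add: B_top_def B_bot_def)
    have vars: "xsym e (k - 1) = (mvar (k - 1) :: 'a mpoly)" "xsym e (2 * k) = (mvar (2 * k) :: 'a mpoly)"
      using bounds(1,2) less_imp_diff_less[of k e 1] by (simp_all add: xsym_def)
    have "B_mat e k $$ (0, 0) = (mvar (k - 1) :: 'a mpoly)"
      "B_mat e k $$ (1, 0) = (mvar (2 * k) :: 'a mpoly)"
      "B_mat e k $$ (0, c - 2 * k + 1) = (xsym e c :: 'a mpoly)"
      "B_mat e k $$ (1, c - 2 * k + 1) = (xsym e (c + k + 1) :: 'a mpoly)"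
      unfolding B_mat_def using j(1,2)
      by (simp_all only: index_mat(1) pos2 one_less_numeral_iff Num.rel_simps case_prod_conv
          indices vars refl if_True if_False one_neq_zero)
    then show ?thesis
      using minor_B[OF j(1,2)] by (simp only:)
  qed
qed

lemma mpoly_subst_diff: "mpoly_subst f (p - q) = mpoly_subst f p - mpoly_subst f q"
  using mpoly_subst_add[of f "p - q" q] by simp

lemma param_map_xsym: "param_map e (xsym e n :: 'a::comm_ring_1 mpoly) = Polynomial.monom 1 (e + n)"
proof (cases "n < e")
  case True
  then show ?thesis by (simp add: param_map_def xsym_def mpoly_subst_mvar)
next
  case False
  then obtain d where d: "n = e + d" using le_Suc_ex not_less by blast
  show ?thesis
  proof (cases "even d")
    case True
    then obtain i where "d = i + i" by (metis evenE mult_2)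
    then show ?thesis
      by (simp add: d param_map_def xsym_def power2_eq_square mpoly_subst_mult mpoly_subst_mvar
          mult_monom ac_simps)
  next
    case False
    then obtain i where "d = Suc (i + i)" by (metis oddE mult_2 Suc_eq_plus1)
    then show ?thesis
      by (simp add: d param_map_def xsym_def mpoly_subst_mult mpoly_subst_mvar mult_monom ac_simps)
  qed
qed

text \<open>
  When the weight rises by the same amount \<open>\<delta>\<close> from top to bottom in every column, both
  products in a minor have the same weight.
\<close>

lemma minors_ideal_le_semigroup_ideal:
  fixes M :: "'a::comm_ring_1 mpoly mat"
  assumes dim: "dim_row M = 2"
    and entries: "\<And>r j. r < 2 \<Longrightarrow> j < dim_col M \<Longrightarrow> M $$ (r, j) \<in> carrier (coord_ring e k)"
    and top: "\<And>j. j < dim_col M \<Longrightarrow> param_map e (M $$ (0, j)) = Polynomial.monom 1 (w j)"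
    and bot: "\<And>j. j < dim_col M \<Longrightarrow> param_map e (M $$ (1, j)) = Polynomial.monom 1 (w j + \<delta>)"
  shows "minors_ideal (coord_ring e k) 2 M \<subseteq> semigroup_ideal e k"
  unfolding coord_ring_def
proof (rule minors_ideal_two_rows(3)[OF dim])
  show "M $$ (r, j) \<in> carrier (mpoly_ring ({0..<e} - {k..<2 * k}))" if "r < 2" "j < dim_col M" for r j
    using entries[OF that] by (simp only: coord_ring_def)
  show "ideal (semigroup_ideal e k :: 'a mpoly set) (mpoly_ring ({0..<e} - {k..<2 * k}))"
    using ideal_semigroup_ideal[of e k] by (simp only: coord_ring_def)
  fix i j assume ij: "i < dim_col M" "j < dim_col M"
  have "M $$ (0, i) * M $$ (1, j) - M $$ (1, i) * M $$ (0, j) \<in> carrier (coord_ring e k)"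
    using entries ij unfolding coord_ring_def
    by (intro mpoly_ring_minus_closed mpoly_ring_mult_closed) simp_all
  moreover have "param_map e (M $$ (0, i) * M $$ (1, j) - M $$ (1, i) * M $$ (0, j)) = 0"
    using top[OF ij(1)] top[OF ij(2)] bot[OF ij(1)] bot[OF ij(2)]
    by (simp add: param_map_def mpoly_subst_diff mpoly_subst_mult mult_monom ac_simps)
  ultimately show "M $$ (0, i) * M $$ (1, j) - M $$ (1, i) * M $$ (0, j) \<in> semigroup_ideal e k"
    by (simp add: semigroup_ideal_alt)
qed

lemma minors_A_B_le_semigroup_ideal:
  assumes "1 \<le> k" "2 * k \<le> e - 1" "4 \<le> e - k"
  shows "minors_ideal (coord_ring e k) 2 (A_mat e k) \<subseteq> (semigroup_ideal e k :: 'a::comm_ring_1 mpoly set)"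
    and "minors_ideal (coord_ring e k) 2 (B_mat e k) \<subseteq> (semigroup_ideal e k :: 'a mpoly set)"
proof -
  have B_bot: "B_bot k j = B_top k j + (k + 1)" for j
    using assms(1) by (simp add: B_top_def B_bot_def)
  show "minors_ideal (coord_ring e k) 2 (A_mat e k) \<subseteq> (semigroup_ideal e k :: 'a mpoly set)"
  proof (rule minors_ideal_le_semigroup_ideal[where w = "\<lambda>j. e + A_top k j" and \<delta> = 1])
    show "A_mat e k $$ (r, j) \<in> carrier (coord_ring e k :: 'a mpoly ring)"
      if "r < 2" "j < dim_col (A_mat e k :: 'a mpoly mat)" for r j
      using A_B_mat_closed(1)[OF assms that(1)] that(2) by simp
  qed (simp_all add: A_mat_def param_map_xsym)
  show "minors_ideal (coord_ring e k) 2 (B_mat e k) \<subseteq> (semigroup_ideal e k :: 'a mpoly set)"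
  proof (rule minors_ideal_le_semigroup_ideal[where w = "\<lambda>j. e + B_top k j" and \<delta> = "k + 1"])
    show "B_mat e k $$ (r, j) \<in> carrier (coord_ring e k :: 'a mpoly ring)"
      if "r < 2" "j < dim_col (B_mat e k :: 'a mpoly mat)" for r j
      using A_B_mat_closed(2)[OF assms that(1)] that(2) by simp
  qed (simp_all add: B_mat_def param_map_xsym B_bot add.assoc)
qed

lemma semigroup_ideal_le:
  fixes J :: "'a::comm_ring_1 mpoly set"
  assumes bounds: "1 \<le> k" "2 * k < e" "k + 4 \<le> e"
    and J: "ideal J (coord_ring e k)"
    and A: "minors_ideal (coord_ring e k) 2 (A_mat e k) \<subseteq> J"
    and B: "minors_ideal (coord_ring e k) 2 (B_mat e k) \<subseteq> J"
  shows "semigroup_ideal e k \<subseteq> J"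
proof
  interpret minor_congruence e k mvar "\<lambda>p q. p - q \<in> J" "xsym e"
    using minors_ideals_congruence[OF assms] .
  let ?V = "{0..<e} - {k..<2 * k}"
  define w where "w m = (SOME n. wmon n (Poly_Mapping.single m 1))" for m
  have w: "wmon (w m) (Poly_Mapping.single m 1)" if "Poly_Mapping.keys m \<subseteq> ?V" for m
    unfolding w_def using monomial_of_weight_single[OF that] by (rule someI_ex)
  fix p :: "'a mpoly" assume "p \<in> semigroup_ideal e k"
  then have "p \<in> carrier (mpoly_ring ?V)" "param_map e p = 0"
    by (simp_all add: semigroup_ideal_alt coord_ring_def)
  then show "p \<in> J"
  proof (rule mem_ideal_if_param_map_eq_0[OF J[unfolded coord_ring_def], where w = w, rotated 2])
    fix m :: "nat \<Rightarrow>\<^sub>0 nat" assume m: "Poly_Mapping.keys m \<subseteq> ?V"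
    show "param_map e (Poly_Mapping.single m (1 :: 'a)) = Polynomial.monom 1 (w m)"
      using param_map_monomial_of_weight[OF w[OF m]] .
    fix m' :: "nat \<Rightarrow>\<^sub>0 nat" assume m': "Poly_Mapping.keys m' \<subseteq> ?V" "w m = w m'"
    show "Poly_Mapping.single m 1 - Poly_Mapping.single m' 1 \<in> J"
      using same_weight_eqv[OF w[OF m]] w[OF m'(1)] m'(2) by simp
  qed
qed

theorem theorem3p5:
  fixes e k :: nat
  assumes "1 \<le> e" and "1 \<le> k" and "2 * k \<le> e - 1" and "4 \<le> e - k"
  shows "(semigroup_ideal e k :: 'a::field mpoly set) =
    minors_ideal (coord_ring e k) 2 (A_mat e k)
      <+>\<^bsub>(coord_ring e k :: 'a mpoly ring)\<^esub>
    minors_ideal (coord_ring e k) 2 (B_mat e k)"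
    (is "?I = ?A <+>\<^bsub>?R\<^esub> ?B")
proof
  interpret cring ?R unfolding coord_ring_def by (rule cring_mpoly_ring)
  have bounds: "1 \<le> k" "2 * k < e" "k + 4 \<le> e" using assms by linarith+
  have idA: "ideal ?A ?R" and idB: "ideal ?B ?R"
    unfolding coord_ring_def using A_B_mat_closed[OF assms(2-4), unfolded coord_ring_def]
    by (auto intro!: minors_ideal_two_rows(1))
  note zero = mpoly_ideal_0[OF idA[unfolded coord_ring_def], folded coord_ring_def]
    mpoly_ideal_0[OF idB[unfolded coord_ring_def], folded coord_ring_def]
  have sum: "?A <+>\<^bsub>?R\<^esub> ?B = {a + b | a b. a \<in> ?A \<and> b \<in> ?B}"
    by (auto simp: set_add_def' coord_ring_def mpoly_ring_simps)
  show "?I \<subseteq> ?A <+>\<^bsub>?R\<^esub> ?B"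
  proof (rule semigroup_ideal_le[OF bounds add_ideals[OF idA idB]])
    show "?A \<subseteq> ?A <+>\<^bsub>?R\<^esub> ?B" unfolding sum using zero(2) by force
    show "?B \<subseteq> ?A <+>\<^bsub>?R\<^esub> ?B" unfolding sum using zero(1) by force
  qed
  show "?A <+>\<^bsub>?R\<^esub> ?B \<subseteq> ?I"
    unfolding sum using minors_A_B_le_semigroup_ideal[OF assms(2-4)]
      mpoly_ideal_add[OF ideal_semigroup_ideal[unfolded coord_ring_def]] by blast
qed

end
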